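(* Let $R$ be a centrally essential ring. Then $R$ is a right uniserial, right Noetherian ring if and only if $R$ is a commutative discrete valuation domain or a (not necessarily commutative) uniserial Artinian ring.
   Context: All rings are associative with a non-zero identity element. A ring $R$ with center $C$ is centrally essential if for every non-zero $r\in R$ there exist two non-zero central elements $c,d\in C$ with $rc=d$. A module is uniserial if the set of all its submodules is linearly ordered by inclusion; a ring $R$ is right (left) uniserial if the module $R_R$ (resp. ${}_RR$) is uniserial. A ring is called uniserial (resp. Artinian) without a side specified if it is both left and right uniserial (resp. both left and right Artinian). *)

theory Defs
  imports "HOL-Algebra.Algebra"
begin

text \<open>
  As in HOL-Algebra, a ring is associative and unital, but the zero ring satisfies the
  locale \<^locale>\<open>ring\<close>; non-triviality has to be assumed separately.
\<close>

definition ring_center :: "('a, 'b) ring_scheme \<Rightarrow> 'a set"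
  where "ring_center R =
    {c \<in> carrier R. \<forall>x \<in> carrier R. c \<otimes>\<^bsub>R\<^esub> x = x \<otimes>\<^bsub>R\<^esub> c}"

definition centrally_essential :: "('a, 'b) ring_scheme \<Rightarrow> bool"
  where "centrally_essential R \<longleftrightarrow>
    (\<forall>r \<in> carrier R - {\<zero>\<^bsub>R\<^esub>}.
      \<exists>c \<in> ring_center R - {\<zero>\<^bsub>R\<^esub>}. \<exists>d \<in> ring_center R - {\<zero>\<^bsub>R\<^esub>}.
        r \<otimes>\<^bsub>R\<^esub> c = d)"

text \<open>
  The modules of HOL-Algebra are modules over commutative rings, so the submodules of the
  regular modules $R_R$ and ${}_RR$ are described directly: they are the one-sided ideals.
\<close>

locale right_ideal = additive_subgroup I R + ring R for I and R (structure) +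
  assumes r_closed: "\<lbrakk>a \<in> I; x \<in> carrier R\<rbrakk> \<Longrightarrow> a \<otimes> x \<in> I"

locale left_ideal = additive_subgroup I R + ring R for I and R (structure) +
  assumes l_closed: "\<lbrakk>a \<in> I; x \<in> carrier R\<rbrakk> \<Longrightarrow> x \<otimes> a \<in> I"

definition right_uniserial :: "('a, 'b) ring_scheme \<Rightarrow> bool"
  where "right_uniserial R \<longleftrightarrow>
    (\<forall>I J. right_ideal I R \<longrightarrow> right_ideal J R \<longrightarrow> I \<subseteq> J \<or> J \<subseteq> I)"

definition left_uniserial :: "('a, 'b) ring_scheme \<Rightarrow> bool"
  where "left_uniserial R \<longleftrightarrow>
    (\<forall>I J. left_ideal I R \<longrightarrow> left_ideal J R \<longrightarrow> I \<subseteq> J \<or> J \<subseteq> I)"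

definition uniserial :: "('a, 'b) ring_scheme \<Rightarrow> bool"
  where "uniserial R \<longleftrightarrow> right_uniserial R \<and> left_uniserial R"

definition right_noetherian :: "('a, 'b) ring_scheme \<Rightarrow> bool"
  where "right_noetherian R \<longleftrightarrow>
    (\<forall>I :: nat \<Rightarrow> 'a set. (\<forall>n. right_ideal (I n) R) \<longrightarrow> mono I \<longrightarrow>
      (\<exists>N. \<forall>n \<ge> N. I n = I N))"

definition right_artinian :: "('a, 'b) ring_scheme \<Rightarrow> bool"
  where "right_artinian R \<longleftrightarrow>
    (\<forall>I :: nat \<Rightarrow> 'a set. (\<forall>n. right_ideal (I n) R) \<longrightarrow> antimono I \<longrightarrow>
      (\<exists>N. \<forall>n \<ge> N. I n = I N))"

definition left_artinian :: "('a, 'b) ring_scheme \<Rightarrow> bool"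
  where "left_artinian R \<longleftrightarrow>
    (\<forall>I :: nat \<Rightarrow> 'a set. (\<forall>n. left_ideal (I n) R) \<longrightarrow> antimono I \<longrightarrow>
      (\<exists>N. \<forall>n \<ge> N. I n = I N))"

definition artinian :: "('a, 'b) ring_scheme \<Rightarrow> bool"
  where "artinian R \<longleftrightarrow> right_artinian R \<and> left_artinian R"

text \<open>
  A discrete valuation domain is a commutative principal ideal domain with exactly one
  non-zero maximal ideal. Fields are excluded: their only maximal ideal is zero.
\<close>

locale discrete_valuation_domain = principal_domain R for R (structure) +
  assumes unique_nonzero_maximal: "\<exists>!M. maximalideal M R \<and> M \<noteq> {\<zero>}"

end

theory Submission
  imports Defs
begin

text \<open>
  Suppose that \<open>R\<close> is right uniserial and right Noetherian. Then \<open>R\<close> is local with non-units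
  \<open>pR\<close>, and every right ideal is principal and two-sided. Each non-zero \<open>r\<close> has a
  central multiplier \<open>c\<close> with \<open>rc \<noteq> 0\<close> central, and if \<open>c\<close> is a unit, \<open>r\<close> itself is central.

  If \<open>p\<close> is nilpotent, with \<open>p\<^sup>n = 0\<close> and \<open>n\<close> minimal, then \<open>p\<^sup>n\<^sup>-\<^sup>1\<close> is central. This forces
  \<open>pR = Rp\<close>, so the powers of \<open>pR\<close> are all the right ideals and all the left ideals.

  If \<open>p\<close> is not nilpotent, then \<open>P = \<Inter>p\<^sup>kR\<close> satisfies \<open>P = pP\<close>. Were \<open>P \<noteq> 0\<close>, all central
  non-units would lie in \<open>P\<close>, and dividing a suitable central \<open>d \<in> P\<close> repeatedly by \<open>p\<close> would
  yield central elements generating a strictly increasing sequence of right ideals. So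
  \<open>P = 0\<close>, which makes \<open>R\<close> a domain, and a centrally essential domain is commutative.
\<close>

section \<open>One-sided ideals and chain conditions\<close>

context ring
begin

lemma additive_subgroup_of_closed:
  assumes "H \<subseteq> carrier R" "\<zero> \<in> H"
    and "\<And>x y. x \<in> H \<Longrightarrow> y \<in> H \<Longrightarrow> x \<oplus> y \<in> H"
    and "\<And>x. x \<in> H \<Longrightarrow> \<ominus> x \<in> H"
  shows "additive_subgroup H R"
proof -
  have "subgroup H (add_monoid R)"
    using assms by (auto intro!: add.subgroupI)
  then show ?thesis
    by (rule additive_subgroupI)
qed

lemma right_ideal_multiples:
  assumes "a \<in> carrier R"
  shows "right_ideal {x \<in> carrier R. a divides x} R"
proof -
  have "additive_subgroup {x \<in> carrier R. a divides x} R"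
  proof (rule additive_subgroup_of_closed; clarsimp)
    show "a divides \<zero>"
      using assms by (auto intro: dividesI[of \<zero>])
  next
    fix x y assume "a divides x" "a divides y"
    then obtain r s where "r \<in> carrier R" "x = a \<otimes> r" "s \<in> carrier R" "y = a \<otimes> s"
      by blast
    then show "a divides (x \<oplus> y)"
      using assms by (auto simp: r_distr intro!: dividesI[of "r \<oplus> s"])
  next
    fix x assume "a divides x"
    then obtain r where "r \<in> carrier R" "x = a \<otimes> r" by blast
    then show "a divides (\<ominus> x)"
      using assms by (auto simp: r_minus intro!: dividesI[of "\<ominus> r"])
  qed
  then show ?thesis
    using assms divides_prod_r
    by (simp add: right_ideal_def right_ideal_axioms_def ring_axioms)
qed

lemma left_ideal_multiples:
  assumes "a \<in> carrier R"
  shows "left_ideal {r \<otimes> a | r. r \<in> carrier R} R"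
proof -
  have "additive_subgroup {r \<otimes> a | r. r \<in> carrier R} R"
  proof (rule additive_subgroup_of_closed)
    show "{r \<otimes> a | r. r \<in> carrier R} \<subseteq> carrier R"
      using assms by auto
    show "\<zero> \<in> {r \<otimes> a | r. r \<in> carrier R}"
      using assms by (metis (mono_tags, lifting) l_null mem_Collect_eq zero_closed)
  next
    fix x y assume "x \<in> {r \<otimes> a | r. r \<in> carrier R}" "y \<in> {r \<otimes> a | r. r \<in> carrier R}"
    then obtain r s where "r \<in> carrier R" "x = r \<otimes> a" "s \<in> carrier R" "y = s \<otimes> a"
      by blast
    then show "x \<oplus> y \<in> {r \<otimes> a | r. r \<in> carrier R}"
      using assms l_distr[of r s a] by (auto intro!: exI[of _ "r \<oplus> s"])
  next
    fix x assume "x \<in> {r \<otimes> a | r. r \<in> carrier R}"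
    then obtain r where "r \<in> carrier R" "x = r \<otimes> a" by blast
    then show "\<ominus> x \<in> {r \<otimes> a | r. r \<in> carrier R}"
      using assms l_minus[of r a] by (auto intro!: exI[of _ "\<ominus> r"])
  qed
  moreover have "y \<otimes> x \<in> {r \<otimes> a | r. r \<in> carrier R}"
    if "x \<in> {r \<otimes> a | r. r \<in> carrier R}" "y \<in> carrier R" for x y
    using that assms m_assoc[symmetric] by blast
  ultimately show ?thesis
    by (simp add: left_ideal_def left_ideal_axioms_def ring_axioms)
qed

lemma right_ideal_Union_mono:
  fixes I :: "nat \<Rightarrow> 'a set"
  assumes "\<And>n. right_ideal (I n) R" "mono I"
  shows "right_ideal (\<Union>n. I n) R"
proof -
  have sub: "additive_subgroup (I n) R" for n
    using assms(1) by (simp add: right_ideal_def)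
  have "additive_subgroup (\<Union>n. I n) R"
  proof (rule additive_subgroup_of_closed)
    show "(\<Union>n. I n) \<subseteq> carrier R"
      using sub additive_subgroup.a_subset by blast
    show "\<zero> \<in> (\<Union>n. I n)"
      using sub additive_subgroup.zero_closed by blast
  next
    fix x y assume "x \<in> (\<Union>n. I n)" "y \<in> (\<Union>n. I n)"
    then obtain m n where "x \<in> I m" "y \<in> I n" by blast
    then have "x \<in> I (max m n)" "y \<in> I (max m n)"
      using monoD[OF assms(2), of m "max m n"] monoD[OF assms(2), of n "max m n"] by auto
    then show "x \<oplus> y \<in> (\<Union>n. I n)"
      using additive_subgroup.a_closed[OF sub] by blast
  next
    fix x assume "x \<in> (\<Union>n. I n)"
    then obtain n where "x \<in> I n" by blast
    then show "\<ominus> x \<in> (\<Union>n. I n)"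
      using additive_subgroup.a_inv_closed[OF sub] abelian_group_axioms by blast
  qed
  moreover have "\<And>a x. a \<in> (\<Union>n. I n) \<Longrightarrow> x \<in> carrier R \<Longrightarrow> a \<otimes> x \<in> (\<Union>n. I n)"
    using right_ideal.r_closed[OF assms(1)] by blast
  ultimately show ?thesis
    by (simp add: right_ideal_def right_ideal_axioms_def ring_axioms)
qed

lemma right_ideal_divides:
  assumes "right_ideal I R" "a \<in> I" "a divides b"
  shows "b \<in> I"
proof -
  obtain c where "c \<in> carrier R" "b = a \<otimes> c"
    using assms(3) by blast
  then show ?thesis
    using right_ideal.r_closed[OF assms(1,2)] by simp
qed

end

lemma right_ideal_subset: "right_ideal I R \<Longrightarrow> I \<subseteq> carrier R"
  by (simp add: right_ideal_def additive_subgroup.a_subset)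

lemma left_ideal_subset: "left_ideal I R \<Longrightarrow> I \<subseteq> carrier R"
  by (simp add: left_ideal_def additive_subgroup.a_subset)

section \<open>The chain conditions through extremal one-sided ideals\<close>

lemma right_noetherian_maximal:
  assumes "right_noetherian R" "F \<noteq> {}" "\<And>I. I \<in> F \<Longrightarrow> right_ideal I R"
  obtains M where "M \<in> F" "\<And>I. I \<in> F \<Longrightarrow> M \<subseteq> I \<Longrightarrow> I = M"
proof (rule ccontr)
  assume "\<not> thesis"
  then have step: "\<exists>I. I \<in> F \<and> M \<subset> I" if "M \<in> F" for M
    using that \<open>\<And>M. M \<in> F \<Longrightarrow> (\<And>I. I \<in> F \<Longrightarrow> M \<subseteq> I \<Longrightarrow> I = M) \<Longrightarrow> thesis\<close>
    by (metis psubsetI)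
  \<comment> \<open>Dependent choice turns the absence of a maximal member into a strictly
    increasing sequence, which the chain condition forbids.\<close>
  have "\<exists>f. \<forall>n. f n \<in> F \<and> f n \<subset> f (Suc n)"
    by (rule dependent_nat_choice) (use assms(2) step in auto)
  then obtain f where f: "\<And>n. f n \<in> F" "\<And>n. f n \<subset> f (Suc n)"
    by blast
  have "mono f"
    using f(2) by (simp add: mono_iff_le_Suc less_imp_le)
  then obtain N where "\<forall>n\<ge>N. f n = f N"
    using assms(1,3) f(1) unfolding right_noetherian_def by metis
  then show False
    using f(2)[of N] by (metis le_Suc_eq less_irrefl order_refl)
qed

lemma left_artinian_minimal:
  assumes "left_artinian R" "F \<noteq> {}" "\<And>I. I \<in> F \<Longrightarrow> left_ideal I R"
  obtains M where "M \<in> F" "\<And>I. I \<in> F \<Longrightarrow> I \<subseteq> M \<Longrightarrow> I = M"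
proof (rule ccontr)
  assume "\<not> thesis"
  then have step: "\<exists>I. I \<in> F \<and> I \<subset> M" if "M \<in> F" for M
    using that \<open>\<And>M. M \<in> F \<Longrightarrow> (\<And>I. I \<in> F \<Longrightarrow> I \<subseteq> M \<Longrightarrow> I = M) \<Longrightarrow> thesis\<close>
    by (metis psubsetI)
  have "\<exists>f. \<forall>n. f n \<in> F \<and> f (Suc n) \<subset> f n"
    by (rule dependent_nat_choice) (use assms(2) step in auto)
  then obtain f where f: "\<And>n. f n \<in> F" "\<And>n. f (Suc n) \<subset> f n"
    by blast
  have "antimono f"
    using f(2) by (simp add: antimono_iff_le_Suc less_imp_le)
  then obtain N where "\<forall>n\<ge>N. f n = f N"
    using assms(1,3) f(1) unfolding left_artinian_def by metis
  then show False
    using f(2)[of N] by (metis le_Suc_eq less_irrefl order_refl)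
qed

text \<open>A finite range has an inclusion-minimal member \<open>I N\<close>, and all later terms
  lie below it.\<close>

lemma antimono_finite_range_stabilizes:
  fixes I :: "nat \<Rightarrow> 'a set"
  assumes "antimono I" "finite (range I)"
  shows "\<exists>N. \<forall>n\<ge>N. I n = I N"
proof -
  have "\<exists>M\<in>range I. \<forall>L\<in>range I. L \<subseteq> M \<longrightarrow> M = L"
    using assms(2) by (intro finite_has_minimal) auto
  then obtain N where N: "\<And>n. I n \<subseteq> I N \<Longrightarrow> I N = I n"
    by auto
  then show ?thesis
    using antimonoD[OF assms(1)] by (metis (no_types))
qed

section \<open>Rings in which divisibility is total\<close>

text \<open>
  Here \<open>a divides b\<close> means \<open>b \<in> aR\<close>, so totality of divisibility is right uniseriality.
\<close>

locale right_chain_ring = ring R for R (structure) +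
  assumes one_not_zero: "\<one> \<noteq> \<zero>"
    and divides_total: "a \<in> carrier R \<Longrightarrow> b \<in> carrier R \<Longrightarrow> a divides b \<or> b divides a"

text \<open>Principal right ideals decide: for \<open>a\<close> in \<open>I - J\<close> and
  \<open>b\<close> in \<open>J - I\<close>, if either divides the other, the multiple lies in the
  ideal that was to omit it.\<close>

lemma (in ring) right_uniserial_iff:
  "right_uniserial R \<longleftrightarrow>
    (\<forall>a\<in>carrier R. \<forall>b\<in>carrier R. a divides b \<or> b divides a)"
proof
  assume uni: "right_uniserial R"
  show "\<forall>a\<in>carrier R. \<forall>b\<in>carrier R. a divides b \<or> b divides a"
  proof (intro ballI)
    fix a b assume ab: "a \<in> carrier R" "b \<in> carrier R"
    then have "{x \<in> carrier R. a divides x} \<subseteq> {x \<in> carrier R. b divides x} \<or>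
        {x \<in> carrier R. b divides x} \<subseteq> {x \<in> carrier R. a divides x}"
      using uni right_ideal_multiples unfolding right_uniserial_def by blast
    then show "a divides b \<or> b divides a"
      using ab divides_refl by blast
  qed
next
  assume total: "\<forall>a\<in>carrier R. \<forall>b\<in>carrier R. a divides b \<or> b divides a"
  show "right_uniserial R"
    unfolding right_uniserial_def
  proof (intro allI impI)
    fix I J assume IJ: "right_ideal I R" "right_ideal J R"
    show "I \<subseteq> J \<or> J \<subseteq> I"
    proof (rule ccontr)
      assume "\<not> (I \<subseteq> J \<or> J \<subseteq> I)"
      then obtain a b where "a \<in> I" "a \<notin> J" "b \<in> J" "b \<notin> I" by blast
      moreover from this have "a divides b \<or> b divides a"
        using total right_ideal_subset[OF IJ(1)] right_ideal_subset[OF IJ(2)] by blast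
      ultimately show False
        using right_ideal_divides[OF IJ(1)] right_ideal_divides[OF IJ(2)] by blast
    qed
  qed
qed

context right_chain_ring
begin

section \<open>Units, local structure and Nakayama's lemma\<close>

lemma Units_of_right_inverse:
  assumes a: "a \<in> carrier R" and b: "b \<in> carrier R" and ab: "a \<otimes> b = \<one>"
  shows "a \<in> Units R"
proof -
  \<comment> \<open>This is an idempotent. Comparing it with \<open>\<one> \<ominus> e\<close>
    leaves only \<open>\<zero>\<close> and \<open>\<one>\<close>, and
    \<open>a \<otimes> e \<otimes> b = \<one>\<close> excludes \<open>\<zero>\<close>.\<close>
  define e where "e = b \<otimes> a"
  have e: "e \<in> carrier R" "\<one> \<ominus> e \<in> carrier R"
    using a b by (auto simp: e_def)
  have ee: "e \<otimes> e = e"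
    unfolding e_def using a b ab by (metis m_assoc m_closed r_one)
  have z: "e \<otimes> (\<one> \<ominus> e) = \<zero>" "(\<one> \<ominus> e) \<otimes> e = \<zero>"
    using e(1) ee by (simp_all add: minus_eq r_distr l_distr r_minus l_minus r_neg)
  have "e = \<one>"
    using divides_total[OF e]
  proof
    assume "e divides (\<one> \<ominus> e)"
    then obtain x where "x \<in> carrier R" "\<one> \<ominus> e = e \<otimes> x" by blast
    then have "\<one> \<ominus> e = e \<otimes> (\<one> \<ominus> e)"
      using e ee by (metis m_assoc)
    then show ?thesis using z e by (simp add: r_right_minus_eq)
  next
    assume "(\<one> \<ominus> e) divides e"
    then obtain x where x: "x \<in> carrier R" "e = (\<one> \<ominus> e) \<otimes> x" by blast
    have "e \<otimes> e = e \<otimes> ((\<one> \<ominus> e) \<otimes> x)"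
      using x(2) by (rule arg_cong)
    also have "\<dots> = \<zero>"
      using m_assoc[of e "\<one> \<ominus> e" x, symmetric] e x(1) z by simp
    finally have "e = \<zero>"
      using ee by simp
    moreover have "a \<otimes> e \<otimes> b = \<one>"
      unfolding e_def using a b ab by (metis m_assoc m_closed r_one)
    ultimately show ?thesis
      using a b one_not_zero by simp
  qed
  then show ?thesis
    using a b ab by (auto simp: Units_def e_def)
qed

lemma nonunit_mult_right:
  assumes "a \<in> carrier R - Units R" "x \<in> carrier R"
  shows "a \<otimes> x \<in> carrier R - Units R"
proof (rule ccontr)
  assume "a \<otimes> x \<notin> carrier R - Units R"
  then have ax: "a \<otimes> x \<in> Units R"
    using assms by auto
  then have "a \<otimes> (x \<otimes> inv (a \<otimes> x)) = \<one>"
    using assms by (simp add: m_assoc[symmetric])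
  then have "a \<in> Units R"
    using ax assms by (intro Units_of_right_inverse[of a "x \<otimes> inv (a \<otimes> x)"]) auto
  then show False
    using assms(1) by blast
qed

text \<open>If \<open>x \<otimes> a\<close> is a unit, then \<open>a\<close> has a left inverse
  \<open>l\<close>. As \<open>l\<close> has the right inverse \<open>a\<close>, it is a unit, and
  \<open>a\<close> is its inverse.\<close>

lemma nonunit_mult_left:
  assumes "a \<in> carrier R - Units R" "x \<in> carrier R"
  shows "x \<otimes> a \<in> carrier R - Units R"
proof (rule ccontr)
  assume "x \<otimes> a \<notin> carrier R - Units R"
  then have xa: "x \<otimes> a \<in> Units R"
    using assms by auto
  define l where "l = inv (x \<otimes> a) \<otimes> x"
  have l: "l \<in> carrier R" "l \<otimes> a = \<one>"
    using xa assms by (auto simp: l_def m_assoc)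
  then have "l \<in> Units R"
    using Units_of_right_inverse assms(1) by blast
  then have "a = inv l"
    using l assms(1) by (metis DiffD1 Units_inv_closed Units_l_inv l_one m_assoc r_one)
  then show False
    using \<open>l \<in> Units R\<close> assms(1) by auto
qed

text \<open>Of \<open>j\<close> and \<open>\<one> \<ominus> j\<close>, the one that divides the
  other also divides their sum \<open>\<one>\<close> and is therefore a unit; \<open>j\<close> is
  not.\<close>

lemma one_minus_nonunit:
  assumes "j \<in> carrier R - Units R"
  shows "\<one> \<ominus> j \<in> Units R"
proof (rule ccontr)
  assume nu: "\<one> \<ominus> j \<notin> Units R"
  have j: "j \<in> carrier R" "\<one> \<ominus> j \<in> carrier R"
    using assms by auto
  have sum: "j \<oplus> (\<one> \<ominus> j) = \<one>"
    using j by (metis a_comm add.inv_closed minus_eq one_closed r_neg2)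
  show False
    using divides_total[OF j]
  proof
    assume "j divides (\<one> \<ominus> j)"
    then obtain x where x: "x \<in> carrier R" "\<one> \<ominus> j = j \<otimes> x" by blast
    then have "j \<otimes> (\<one> \<oplus> x) = \<one>"
      using j sum by (simp add: r_distr)
    then show False
      using Units_of_right_inverse[OF j(1), of "\<one> \<oplus> x"] x(1) assms by auto
  next
    assume "(\<one> \<ominus> j) divides j"
    then obtain x where x: "x \<in> carrier R" "j = (\<one> \<ominus> j) \<otimes> x" by blast
    have "(\<one> \<ominus> j) \<otimes> (x \<oplus> \<one>) = (\<one> \<ominus> j) \<otimes> x \<oplus> (\<one> \<ominus> j)"
      using j x(1) by (simp add: r_distr)
    also have "\<dots> = \<one>"
      using sum x(2) by simp
    finally show False
      using Units_of_right_inverse[OF j(2), of "x \<oplus> \<one>"] x(1) nu by auto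
  qed
qed

text \<open>Nakayama's lemma in element form: the unit \<open>\<one> \<ominus> j\<close> can be
  cancelled from \<open>a \<otimes> (\<one> \<ominus> j) = \<zero>\<close>.\<close>

lemma nakayama_right:
  assumes a: "a \<in> carrier R" and j: "j \<in> carrier R - Units R" and eq: "a = a \<otimes> j"
  shows "a = \<zero>"
proof -
  have u: "\<one> \<ominus> j \<in> Units R"
    using one_minus_nonunit j .
  have "a \<otimes> (\<one> \<ominus> j) = a \<ominus> a \<otimes> j"
    using a j by (simp add: minus_eq r_distr r_minus)
  also have "\<dots> = \<zero>"
    using a eq by (metis minus_eq r_neg)
  finally show ?thesis
    using a u by (metis Units_closed Units_inv_closed Units_r_inv l_null m_assoc r_one)
qed

lemma nakayama_left:
  assumes a: "a \<in> carrier R" and j: "j \<in> carrier R - Units R" and eq: "a = j \<otimes> a"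
  shows "a = \<zero>"
proof -
  have u: "\<one> \<ominus> j \<in> Units R"
    using one_minus_nonunit j .
  have "(\<one> \<ominus> j) \<otimes> a = a \<ominus> j \<otimes> a"
    using a j by (simp add: minus_eq l_distr l_minus)
  also have "\<dots> = \<zero>"
    using a eq by (metis minus_eq r_neg)
  finally show ?thesis
    using a u by (metis Units_closed Units_inv_closed Units_l_inv l_one m_assoc r_null)
qed

text \<open>
  If the right ideals did not satisfy the ascending chain condition, a fixed \<open>y \<noteq> 0\<close> could be
  factored as \<open>x j\<^sub>n \<dots> j\<^sub>1\<close> with ever more non-units \<open>j\<^sub>i\<close>; the left ideals generated by
  \<open>j\<^sub>n \<dots> j\<^sub>1\<close> stabilize, whence such a product is zero.
\<close>

lemma right_noetherian_if_left_artinian: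
  assumes "left_artinian R"
  shows "right_noetherian R"
proof (rule ccontr)
  assume "\<not> right_noetherian R"
  then have "\<exists>I :: nat \<Rightarrow> 'a set. (\<forall>n. right_ideal (I n) R) \<and> mono I \<and> (\<forall>N. \<exists>n\<ge>N. I n \<noteq> I N)"
    unfolding right_noetherian_def by simp
  then obtain I :: "nat \<Rightarrow> 'a set"
    where "(\<forall>n. right_ideal (I n) R) \<and> mono I \<and> (\<forall>N. \<exists>n\<ge>N. I n \<noteq> I N)"
    by (rule exE)
  then have I: "\<And>n. right_ideal (I n) R" "mono I" and neq: "\<And>N. \<exists>n\<ge>N. I n \<noteq> I N"
    by simp_all
  have grow: "\<exists>n. \<exists>x\<in>I n. x \<notin> I N" for N
  proof -
    obtain n where "n \<ge> N" "I n \<noteq> I N"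
      using neq by blast
    then show ?thesis
      using monoD[OF I(2) \<open>n \<ge> N\<close>] by blast
  qed
  obtain n0 y where y: "y \<in> I n0" "y \<notin> I 0"
    using grow by blast
  have car: "I n \<subseteq> carrier R" for n
    by (rule right_ideal_subset[OF I(1)])
  have "\<zero> \<in> I 0"
    using I(1) by (meson additive_subgroup.zero_closed right_ideal_def)
  then have "y \<noteq> \<zero>"
    using y(2) by blast
  \<comment> \<open>The generators \<open>q\<close> are the right factors of \<open>y\<close> whose
    left cofactor lies in the chain; a minimal \<open>Rq\<close> is chosen below.\<close>
  define F where "F = {{r \<otimes> q | r. r \<in> carrier R} | q. q \<in> carrier R \<and> (\<exists>n. \<exists>x\<in>I n. y = x \<otimes> q)}"
  have "{r \<otimes> \<one> | r. r \<in> carrier R} \<in> F"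
    unfolding F_def using y(1) r_one[OF subsetD[OF car y(1)], symmetric] one_closed by blast
  then have "F \<noteq> {}" by blast
  moreover have "\<And>L. L \<in> F \<Longrightarrow> left_ideal L R"
    unfolding F_def using left_ideal_multiples by auto
  ultimately obtain M where M: "M \<in> F" "\<And>L. L \<in> F \<Longrightarrow> L \<subseteq> M \<Longrightarrow> L = M"
    using left_artinian_minimal[OF assms] by blast
  then obtain q n x where q: "M = {r \<otimes> q | r. r \<in> carrier R}" "q \<in> carrier R"
    and x: "x \<in> I n" "y = x \<otimes> q"
    unfolding F_def by blast
  \<comment> \<open>With \<open>x'\<close> outside \<open>I n\<close>, \<open>x\<close> is a proper
    multiple of \<open>x'\<close>, so \<open>y = x' \<otimes> (j \<otimes> q)\<close> gains one more
    non-unit factor \<open>j\<close>.\<close>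
  obtain m x' where x': "x' \<in> I m" "x' \<notin> I n"
    using grow by blast
  have xc: "x \<in> carrier R" "x' \<in> carrier R"
    using car x x' by auto
  have "\<not> x divides x'"
    using right_ideal_divides[OF I(1) x(1)] x' by blast
  then obtain j where j: "j \<in> carrier R" "x = x' \<otimes> j"
    using divides_total xc by blast
  have jnu: "j \<in> carrier R - Units R"
  proof -
    have False if "j \<in> Units R"
    proof -
      have "x' = x \<otimes> inv j"
        using that j xc by (simp add: m_assoc)
      then show False
        using that \<open>\<not> x divides x'\<close> by blast
    qed
    then show ?thesis using j by blast
  qed
  have "{r \<otimes> (j \<otimes> q) | r. r \<in> carrier R} \<in> F"
    unfolding F_def using q x x' j xc m_assoc by blast
  moreover have "{r \<otimes> (j \<otimes> q) | r. r \<in> carrier R} \<subseteq> M"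
    unfolding q(1) using q(2) j m_assoc[symmetric] by blast
  ultimately have eq: "{r \<otimes> (j \<otimes> q) | r. r \<in> carrier R} = M"
    using M(2) by blast
  \<comment> \<open>Since \<open>Rq = Rjq\<close>, left multiplication by a non-unit
    \<open>r \<otimes> j\<close> fixes \<open>q\<close>.\<close>
  have "q \<in> M"
    unfolding q(1) using q(2) by (metis (mono_tags, lifting) l_one mem_Collect_eq one_closed)
  then obtain r where "r \<in> carrier R" "q = r \<otimes> (j \<otimes> q)"
    unfolding eq[symmetric] by blast
  then have "q = (r \<otimes> j) \<otimes> q"
    using j q(2) by (simp add: m_assoc)
  then have "q = \<zero>"
    by (rule nakayama_left[OF q(2) nonunit_mult_left[OF jnu \<open>r \<in> carrier R\<close>]])
  then show False
    using \<open>y \<noteq> \<zero>\<close> x xc by simp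
qed

end

section \<open>Adding the ascending chain condition\<close>

text \<open>The ascending chain condition enters only through \<open>least_divisor\<close>: among
  the right ideals \<open>aR\<close> with \<open>a\<close> in \<open>A\<close> there is a largest
  one.\<close>

locale right_chain_noetherian_ring = right_chain_ring +
  assumes least_divisor: "A \<subseteq> carrier R \<Longrightarrow> A \<noteq> {} \<Longrightarrow> \<exists>a\<in>A. \<forall>b\<in>A. a divides b"

text \<open>A maximal member of a family of right ideals \<open>aR\<close> is the greatest one,
  because they are totally ordered.\<close>

lemma (in ring) right_chain_noetherian_ringI:
  assumes "\<one> \<noteq> \<zero>" "right_uniserial R" "right_noetherian R"
  shows "right_chain_noetherian_ring R"
proof
  show "\<one> \<noteq> \<zero>" by fact
  show total: "a divides b \<or> b divides a" if "a \<in> carrier R" "b \<in> carrier R" for a b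
    using that assms(2) right_uniserial_iff by blast
  fix A assume A: "A \<subseteq> carrier R" "A \<noteq> {}"
  define F where "F = (\<lambda>a. {x \<in> carrier R. a divides x}) ` A"
  have "F \<noteq> {}" "\<And>I. I \<in> F \<Longrightarrow> right_ideal I R"
    using A right_ideal_multiples by (auto simp: F_def)
  then obtain M where M: "M \<in> F" "\<And>I. I \<in> F \<Longrightarrow> M \<subseteq> I \<Longrightarrow> I = M"
    using right_noetherian_maximal[OF assms(3)] by blast
  then obtain a where a: "a \<in> A" "M = {x \<in> carrier R. a divides x}"
    unfolding F_def by blast
  have "a divides b" if b: "b \<in> A" for b
  proof (rule ccontr)
    assume no: "\<not> a divides b"
    then have "b divides a"
      using total a b A by blast
    then have "M \<subseteq> {x \<in> carrier R. b divides x}"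
      using a A b divides_trans by blast
    then have "{x \<in> carrier R. b divides x} = M"
      using M(2) b by (auto simp: F_def)
    then show False
      using no a b A divides_refl by blast
  qed
  then show "\<exists>a\<in>A. \<forall>b\<in>A. a divides b"
    using a(1) by blast
qed

context right_chain_noetherian_ring
begin

text \<open>
  Every right ideal is two-sided: otherwise \<open>a = raj\<close> with a non-unit \<open>j\<close>, and the
  right ideals generated by \<open>r\<^sup>n a\<close> would increase strictly.
\<close>

lemma divides_mult_left:
  assumes a: "a \<in> carrier R" and r: "r \<in> carrier R"
  shows "a divides (r \<otimes> a)"
proof (rule ccontr)
  assume no: "\<not> a divides (r \<otimes> a)"
  then obtain j where j: "j \<in> carrier R" "a = r \<otimes> a \<otimes> j"
    using divides_total[OF a m_closed[OF r a]] by blast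
  have jnu: "j \<in> carrier R - Units R"
  proof -
    have False if "j \<in> Units R"
    proof -
      have "r \<otimes> a = a \<otimes> inv j"
        using that j a r by (metis Units_inv_closed Units_r_inv m_assoc m_closed r_one)
      then show False
        using that no by blast
    qed
    then show ?thesis using j by blast
  qed
  \<comment> \<open>Left multiplication of \<open>a = r \<otimes> a \<otimes> j\<close> by powers of
    \<open>r\<close> shows that the right ideals increase with \<open>n\<close>.\<close>
  have pow: "r [^] n \<otimes> a = r [^] Suc n \<otimes> a \<otimes> j" for n :: nat
  proof -
    have "r [^] n \<otimes> a = r [^] n \<otimes> (r \<otimes> a \<otimes> j)"
      using j(2) by simp
    then show ?thesis
      using a r j(1) by (simp add: m_assoc)
  qed
  obtain n :: nat where n: "\<And>m. (r [^] n \<otimes> a) divides (r [^] (m :: nat) \<otimes> a)"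
    using least_divisor[of "range (\<lambda>n :: nat. r [^] n \<otimes> a)"] a r by auto
  then obtain t where t: "t \<in> carrier R" "r [^] Suc n \<otimes> a = r [^] n \<otimes> a \<otimes> t"
    by (meson dividesD)
  \<comment> \<open>At a largest right ideal one can pass to exponent \<open>Suc n\<close> by
    \<open>t\<close> and back by \<open>j\<close>, so the non-unit \<open>t \<otimes> j\<close>
    fixes the generator.\<close>
  have "r [^] n \<otimes> a = (r [^] n \<otimes> a) \<otimes> (t \<otimes> j)"
    using pow[of n] t a r j(1) by (metis m_assoc m_closed nat_pow_closed)
  then have "r [^] n \<otimes> a = \<zero>"
    using a r by (intro nakayama_right[OF _ nonunit_mult_left[OF jnu t(1)]]) simp_all
  moreover have "r [^] m \<otimes> a = \<zero> \<Longrightarrow> a = \<zero>" for m :: nat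
  proof (induction m)
    case 0
    then show ?case using a by simp
  next
    case (Suc m)
    then show ?case using pow[of m] j(1) by simp
  qed
  ultimately have "a = \<zero>" by blast
  then show False
    using no r by (metis divides_refl r_null zero_closed)
qed

lemma exists_uniformizer: "\<exists>p\<in>carrier R - Units R. \<forall>j\<in>carrier R - Units R. p divides j"
proof (rule least_divisor)
  have "\<zero> \<in> carrier R - Units R"
    using one_not_zero Units_r_inv[of \<zero>] by (metis DiffI Units_inv_closed l_null zero_closed)
  then show "carrier R - Units R \<noteq> {}"
    by blast
qed blast

end

section \<open>Centrally essential rings\<close>

lemma (in ring) center_closed: "c \<in> ring_center R \<Longrightarrow> c \<in> carrier R"
  by (simp add: ring_center_def)

lemma (in ring) center_commute: "c \<in> ring_center R \<Longrightarrow> x \<in> carrier R \<Longrightarrow> c \<otimes> x = x \<otimes> c"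
  by (simp add: ring_center_def)

lemma (in ring) center_mult:
  assumes "c \<in> ring_center R" "d \<in> ring_center R"
  shows "c \<otimes> d \<in> ring_center R"
proof -
  have cd: "c \<in> carrier R" "d \<in> carrier R"
    using assms center_closed by auto
  have "c \<otimes> d \<otimes> x = x \<otimes> (c \<otimes> d)" if x: "x \<in> carrier R" for x
  proof -
    have "c \<otimes> d \<otimes> x = c \<otimes> (x \<otimes> d)"
      using cd x center_commute[OF assms(2) x] by (simp add: m_assoc)
    also have "\<dots> = x \<otimes> c \<otimes> d"
      using cd x center_commute[OF assms(1) x] by (simp add: m_assoc[symmetric])
    finally show ?thesis
      using cd x by (simp add: m_assoc)
  qed
  then show ?thesis
    using cd by (simp add: ring_center_def)
qed

lemma (in ring) center_of_mult_unit:
  assumes x: "x \<in> carrier R" and c: "c \<in> ring_center R" "c \<in> Units R"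
    and xc: "x \<otimes> c \<in> ring_center R"
  shows "x \<in> ring_center R"
proof -
  have cc: "c \<in> carrier R"
    using c(1) center_closed by blast
  have "x \<otimes> r = r \<otimes> x" if r: "r \<in> carrier R" for r
  proof -
    have "x \<otimes> r \<otimes> c = x \<otimes> c \<otimes> r"
      using x r cc center_commute[OF c(1) r] by (simp add: m_assoc)
    also have "\<dots> = r \<otimes> x \<otimes> c"
      using x r cc center_commute[OF xc r] by (simp add: m_assoc)
    finally have "x \<otimes> r \<otimes> c \<otimes> inv c = r \<otimes> x \<otimes> c \<otimes> inv c"
      by simp
    then show ?thesis
      using x r cc c(2) by (simp add: m_assoc)
  qed
  then show ?thesis
    using x by (simp add: ring_center_def)
qed

lemma (in ring) centrally_essentialE:
  assumes "centrally_essential R" "r \<in> carrier R" "r \<noteq> \<zero>"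
  obtains c where "c \<in> ring_center R" "r \<otimes> c \<in> ring_center R" "r \<otimes> c \<noteq> \<zero>"
  using assms unfolding centrally_essential_def by blast

text \<open>Since \<open>c\<close> and \<open>a \<otimes> c\<close> are both central, the non-zero
  \<open>c\<close> annihilates the commutator of \<open>a\<close> and \<open>b\<close>.\<close>

lemma (in ring) centrally_essential_domain_commutative:
  assumes "centrally_essential R"
    and integral: "\<And>a b. a \<in> carrier R \<Longrightarrow> b \<in> carrier R \<Longrightarrow> a \<otimes> b = \<zero> \<Longrightarrow> a = \<zero> \<or> b = \<zero>"
    and a: "a \<in> carrier R" and b: "b \<in> carrier R"
  shows "a \<otimes> b = b \<otimes> a"
proof (cases "a = \<zero>")
  case True
  then show ?thesis using b by simp
next
  case False
  then obtain c where c: "c \<in> ring_center R" "a \<otimes> c \<in> ring_center R" "a \<otimes> c \<noteq> \<zero>"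
    using centrally_essentialE[OF assms(1) a] by blast
  have cc: "c \<in> carrier R"
    using c(1) center_closed by blast
  have "a \<otimes> b \<otimes> c = a \<otimes> c \<otimes> b"
    using a b cc center_commute[OF c(1) b] by (simp add: m_assoc)
  also have "\<dots> = b \<otimes> a \<otimes> c"
    using a b cc center_commute[OF c(2) b] by (simp add: m_assoc)
  finally have "(a \<otimes> b \<ominus> b \<otimes> a) \<otimes> c = \<zero>"
    using a b cc by (simp add: minus_eq l_distr l_minus r_neg)
  moreover have "c \<noteq> \<zero>"
    using c(3) a by auto
  ultimately have "a \<otimes> b \<ominus> b \<otimes> a = \<zero>"
    using integral[of "a \<otimes> b \<ominus> b \<otimes> a" c] a b cc by auto
  then show ?thesis
    using a b by (simp add: r_right_minus_eq)
qed

locale uniformized_chain_ring = right_chain_noetherian_ring +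
  fixes p
  assumes uniformizer: "p \<in> carrier R - Units R"
    and uniformizer_divides: "\<And>j. j \<in> carrier R - Units R \<Longrightarrow> p divides j"
    and central_ess: "centrally_essential R"
begin

lemma p_closed [simp]: "p \<in> carrier R"
  using uniformizer by blast

text \<open>A substitute for commutativity: the right ideal generated by \<open>p [^] k\<close> is
  two-sided, so \<open>r\<close> moves past the power at the cost of changing.\<close>

lemma pow_commute:
  assumes "r \<in> carrier R"
  obtains s where "s \<in> carrier R" "r \<otimes> p [^] (k :: nat) = p [^] k \<otimes> s"
  using divides_mult_left[of "p [^] k" r] assms by auto

text \<open>Take the largest \<open>m\<close> for which \<open>p [^] m\<close> divides
  \<open>a\<close>; a non-unit cofactor would contain another \<open>p\<close>.\<close>

lemma eq_pow_mult_unit: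
  assumes "a \<in> carrier R" "\<not> p [^] (k :: nat) divides a"
  shows "\<exists>m<k. \<exists>u\<in>Units R. a = p [^] m \<otimes> u"
  using assms(2)
proof (induction k)
  case 0
  then show ?case
    using assms(1) l_one[OF assms(1), symmetric] by (auto simp: factor_def)
next
  case (Suc k)
  show ?case
  proof (cases "p [^] k divides a")
    case True
    then obtain y where y: "y \<in> carrier R" "a = p [^] k \<otimes> y" by blast
    have "y \<in> Units R"
    proof (rule ccontr)
      assume "y \<notin> Units R"
      then obtain z where "z \<in> carrier R" "y = p \<otimes> z"
        using uniformizer_divides y(1) by blast
      then have "a = p [^] Suc k \<otimes> z"
        using y(2) by (simp add: m_assoc)
      then show False
        using Suc.prems \<open>z \<in> carrier R\<close> by blast
    qed
    then show ?thesis
      using y(2) by blast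
  next
    case False
    then show ?thesis
      using Suc.IH less_Suc_eq by blast
  qed
qed

end

subsection \<open>The nilpotent case\<close>

locale nilpotent_uniformized_chain_ring = uniformized_chain_ring +
  fixes n :: nat
  assumes pow_eq_zero: "p [^] n = \<zero>" and pow_neq_zero: "\<And>m. m < n \<Longrightarrow> p [^] m \<noteq> \<zero>"
begin

lemma n_pos: "0 < n"
  using pow_eq_zero one_not_zero by (cases n) auto

text \<open>For the least \<open>k\<close> with \<open>p [^] k\<close> in \<open>I\<close>, an
  element not divisible by \<open>p [^] k\<close> would be a unit multiple of a smaller power and
  put that power into \<open>I\<close>.\<close>

lemma right_ideal_eq_pow:
  assumes I: "right_ideal I R"
  shows "\<exists>k\<le>n. I = {x \<in> carrier R. p [^] k divides x}"
proof -
  have "p [^] n \<in> I"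
    using I pow_eq_zero by (simp add: right_ideal_def additive_subgroup.zero_closed)
  define k :: nat where "k = (LEAST k. p [^] k \<in> I)"
  have k: "p [^] k \<in> I" "k \<le> n" "\<And>m. p [^] m \<in> I \<Longrightarrow> k \<le> m"
    unfolding k_def using \<open>p [^] n \<in> I\<close> by (auto intro: LeastI Least_le)
  have "p [^] k divides a" if a: "a \<in> I" for a
  proof (rule ccontr)
    assume no: "\<not> p [^] k divides a"
    have ac: "a \<in> carrier R"
      using a right_ideal_subset[OF I] by blast
    then obtain m u where m: "m < k" "u \<in> Units R" "a = p [^] m \<otimes> u"
      using eq_pow_mult_unit[OF ac no] by blast
    then have "p [^] m = a \<otimes> inv u"
      by (simp add: m_assoc Units_closed)
    then have "p [^] m \<in> I"
      using right_ideal.r_closed[OF I a] m(2) by simp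
    then show False
      using k(3) m(1) by fastforce
  qed
  then have "I = {x \<in> carrier R. p [^] k divides x}"
    using right_ideal_subset[OF I] right_ideal_divides[OF I k(1)] by blast
  then show ?thesis
    using k(2) by blast
qed

lemma finite_right_ideals: "finite {I. right_ideal I R}"
proof (rule finite_subset)
  show "{I. right_ideal I R} \<subseteq> (\<lambda>k. {x \<in> carrier R. p [^] k divides x}) ` {..n}"
    using right_ideal_eq_pow by blast
qed simp

text \<open>
  A non-unit central multiplier \<open>c \<in> pR\<close> annihilates \<open>p\<^sup>n\<^sup>-\<^sup>1\<close>, so the multiplier of \<open>p\<^sup>n\<^sup>-\<^sup>1\<close> is a unit.
\<close>

lemma socle_central: "p [^] (n - 1) \<in> ring_center R"
proof -
  have nz: "p [^] (n - 1) \<noteq> \<zero>"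
    using pow_neq_zero n_pos by simp
  then obtain c where c: "c \<in> ring_center R" "p [^] (n - 1) \<otimes> c \<in> ring_center R"
      "p [^] (n - 1) \<otimes> c \<noteq> \<zero>"
    using centrally_essentialE[OF central_ess, of "p [^] (n - 1)"] by auto
  have "c \<in> Units R"
  proof (rule ccontr)
    assume "c \<notin> Units R"
    then obtain y where y: "y \<in> carrier R" "c = p \<otimes> y"
      using uniformizer_divides[of c] center_closed[OF c(1)] by blast
    have "p [^] (n - 1) \<otimes> p = \<zero>"
      using pow_eq_zero n_pos by (cases n) auto
    then show False
      using c(3) y by (simp add: m_assoc[symmetric])
  qed
  then show ?thesis
    using center_of_mult_unit[OF _ c(1) _ c(2)] by simp
qed

text \<open>
  Write \<open>rp = p\<sigma>(r)\<close>. Centrality of \<open>p\<^sup>n\<^sup>-\<^sup>1\<close> makes \<open>\<sigma>\<^sup>n\<^sup>-\<^sup>1\<close> the identity modulo \<open>pR\<close>, so \<open>\<sigma>\<close> is surjective modulo \<open>pR\<close>.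
\<close>

lemma uniformizer_mult_mod:
  assumes r: "r \<in> carrier R" and n2: "2 \<le> n"
  obtains s t where "s \<in> carrier R" "t \<in> carrier R" "p \<otimes> r = s \<otimes> p \<oplus> p \<otimes> (p \<otimes> t)"
proof -
  obtain m where m: "n = Suc (Suc m)"
    using n2 by (metis Suc_le_D numeral_2_eq_2 Suc_le_mono)
  \<comment> \<open>Here \<open>m = n - 2\<close>. Moving \<open>r\<close> past
    \<open>p [^] m\<close> and then past one more \<open>p\<close> makes \<open>s'\<close> equal to
    \<sigma> of \<open>s\<close>, and \<open>s'\<close> agrees with \<open>r\<close> modulo
    \<open>pR\<close>.\<close>
  obtain s where s: "s \<in> carrier R" "r \<otimes> p [^] m = p [^] m \<otimes> s"
    using pow_commute[OF r] .
  obtain s' where s': "s' \<in> carrier R" "s \<otimes> p = p \<otimes> s'"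
    using pow_commute[OF s(1), of 1] by auto
  have "p [^] Suc m \<otimes> r = r \<otimes> p [^] Suc m"
    using socle_central m center_commute[of "p [^] Suc m" r] r by simp
  also have "\<dots> = p [^] m \<otimes> (s \<otimes> p)"
    using r s by (simp add: m_assoc[symmetric])
  also have "\<dots> = p [^] Suc m \<otimes> s'"
    using s' by (simp add: m_assoc)
  finally have eq: "p [^] Suc m \<otimes> (r \<ominus> s') = \<zero>"
    using r s' by (simp add: minus_eq r_distr r_minus r_neg)
  have "r \<ominus> s' \<notin> Units R"
  proof
    assume u: "r \<ominus> s' \<in> Units R"
    then have "p [^] Suc m = p [^] Suc m \<otimes> (r \<ominus> s') \<otimes> inv (r \<ominus> s')"
      by (simp add: m_assoc Units_closed del: nat_pow_Suc)
    then have "p [^] Suc m = \<zero>"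
      using eq u by simp
    then show False
      using pow_neq_zero[of "Suc m"] m by simp
  qed
  then obtain t where t: "t \<in> carrier R" "r \<ominus> s' = p \<otimes> t"
    using uniformizer_divides[of "r \<ominus> s'"] r s'(1) by auto
  have "r = s' \<oplus> (r \<ominus> s')"
    using r s'(1) by (simp add: minus_eq a_lcomm r_neg)
  then have "p \<otimes> r = p \<otimes> s' \<oplus> p \<otimes> (p \<otimes> t)"
    using t s' by (metis p_closed m_closed r_distr)
  then show thesis
    using that s t s'(2) by metis
qed

text \<open>Downward induction from \<open>p [^] n = \<zero>\<close>: the error term of
  \<open>uniformizer_mult_mod\<close> carries one more power of \<open>p\<close> and is covered by
  the next exponent. The case \<open>k = 1\<close> gives the inclusion of \<open>pR\<close> in
  \<open>Rp\<close>.\<close>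

lemma pow_mult_in_left_multiples:
  assumes "1 \<le> k" "k \<le> n" "r \<in> carrier R"
  shows "\<exists>s\<in>carrier R. p [^] k \<otimes> r = s \<otimes> p"
  using assms(2,1,3)
proof (induction k arbitrary: r rule: inc_induct)
  case base
  then show ?case
    using pow_eq_zero by (intro bexI[of _ \<zero>]) auto
next
  case (step k)
  obtain l where l: "k = Suc l"
    using step.prems(1) by (cases k) auto
  obtain s t where st: "s \<in> carrier R" "t \<in> carrier R" "p \<otimes> r = s \<otimes> p \<oplus> p \<otimes> (p \<otimes> t)"
    using uniformizer_mult_mod[OF step.prems(2)] step.hyps step.prems(1) by auto
  obtain s' where s': "s' \<in> carrier R" "p [^] Suc k \<otimes> t = s' \<otimes> p"
    using step.IH[OF _ st(2)] by auto
  have "p [^] k \<otimes> r = p [^] l \<otimes> (p \<otimes> r)"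
    using l step.prems by (simp add: m_assoc)
  also have "\<dots> = p [^] l \<otimes> s \<otimes> p \<oplus> p [^] l \<otimes> (p \<otimes> (p \<otimes> t))"
    using st by (simp add: r_distr m_assoc)
  also have "p [^] l \<otimes> (p \<otimes> (p \<otimes> t)) = p [^] Suc k \<otimes> t"
    using st l by (simp add: m_assoc)
  also have "p [^] l \<otimes> s \<otimes> p \<oplus> p [^] Suc k \<otimes> t = (p [^] l \<otimes> s \<oplus> s') \<otimes> p"
    using st s' by (simp add: l_distr)
  finally show ?case
    by (rule bexI) (use st s' in simp)
qed

section \<open>Moving factors to the left of powers of \<open>p\<close>, and the left ideals\<close>

lemma pow_mult_commute:
  assumes "r \<in> carrier R"
  shows "\<exists>s\<in>carrier R. p [^] (k :: nat) \<otimes> r = s \<otimes> p [^] k"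
  using assms
proof (induction k arbitrary: r)
  case 0
  then show ?case by auto
next
  case (Suc k)
  obtain s where s: "s \<in> carrier R" "p \<otimes> r = s \<otimes> p"
    using pow_mult_in_left_multiples[of 1 r] n_pos Suc.prems by auto
  obtain t where t: "t \<in> carrier R" "p [^] k \<otimes> s = t \<otimes> p [^] k"
    using Suc.IH s(1) by blast
  have "p [^] Suc k \<otimes> r = p [^] k \<otimes> (p \<otimes> r)"
    using Suc.prems by (simp add: m_assoc)
  also have "\<dots> = p [^] k \<otimes> s \<otimes> p"
    using s by (simp add: m_assoc)
  also have "\<dots> = t \<otimes> p [^] Suc k"
    using t by (simp add: m_assoc)
  finally show ?case
    by (rule bexI) (rule t(1))
qed

lemma left_ideal_eq_pow:
  assumes I: "left_ideal I R"
  shows "\<exists>k\<le>n. I = {x \<in> carrier R. p [^] k divides x}"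
proof -
  have "p [^] n \<in> I"
    using I pow_eq_zero by (simp add: left_ideal_def additive_subgroup.zero_closed)
  define k :: nat where "k = (LEAST k. p [^] k \<in> I)"
  have k: "p [^] k \<in> I" "k \<le> n" "\<And>m. p [^] m \<in> I \<Longrightarrow> k \<le> m"
    unfolding k_def using \<open>p [^] n \<in> I\<close> by (auto intro: LeastI Least_le)
  have "p [^] k divides a" if a: "a \<in> I" for a
  proof (rule ccontr)
    assume no: "\<not> p [^] k divides a"
    have ac: "a \<in> carrier R"
      using a left_ideal_subset[OF I] by blast
    then obtain m u where m: "m < k" "u \<in> Units R" "a = p [^] m \<otimes> u"
      using eq_pow_mult_unit[OF ac no] by blast
    \<comment> \<open>The inverse of \<open>u\<close> acts on the right, but a left ideal absorbs
      only left factors; \<open>w\<close> is its counterpart across \<open>p [^] m\<close>.\<close>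
    obtain w where w: "w \<in> carrier R" "p [^] m \<otimes> inv u = w \<otimes> p [^] m"
      using pow_mult_commute[of "inv u" m] m(2) by auto
    have "w \<otimes> a = w \<otimes> p [^] m \<otimes> u"
      using m w(1) by (simp add: m_assoc Units_closed)
    also have "\<dots> = p [^] m"
      using m(2) by (simp add: w(2)[symmetric] m_assoc Units_closed)
    finally have "p [^] m \<in> I"
      using left_ideal.l_closed[OF I a w(1)] by simp
    then show False
      using k(3) m(1) by fastforce
  qed
  moreover have "a \<in> I" if dvd: "p [^] k divides a" for a
  proof -
    obtain r where r: "r \<in> carrier R" "a = p [^] k \<otimes> r"
      using dvd by blast
    obtain s where "s \<in> carrier R" "p [^] k \<otimes> r = s \<otimes> p [^] k"
      using pow_mult_commute[OF r(1)] by blast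
    then show ?thesis
      using left_ideal.l_closed[OF I k(1)] r(2) by simp
  qed
  ultimately have "I = {x \<in> carrier R. p [^] k divides x}"
    using left_ideal_subset[OF I] by blast
  then show ?thesis
    using k(2) by blast
qed

lemma finite_left_ideals: "finite {I. left_ideal I R}"
proof (rule finite_subset)
  show "{I. left_ideal I R} \<subseteq> (\<lambda>k. {x \<in> carrier R. p [^] k divides x}) ` {..n}"
    using left_ideal_eq_pow by blast
qed simp

lemma artinian: "artinian R"
proof -
  have "finite (range I)" if "\<forall>k. right_ideal (I k) R" for I :: "nat \<Rightarrow> 'a set"
    by (rule finite_subset[OF _ finite_right_ideals]) (use that in auto)
  moreover have "finite (range I)" if "\<forall>k. left_ideal (I k) R" for I :: "nat \<Rightarrow> 'a set"
    by (rule finite_subset[OF _ finite_left_ideals]) (use that in auto)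
  ultimately show ?thesis
    unfolding artinian_def right_artinian_def left_artinian_def
    by (auto intro: antimono_finite_range_stabilizes)
qed

text \<open>By \<open>left_ideal_eq_pow\<close> each left ideal is also a right ideal, so left
  comparability is inherited from the right.\<close>

lemma uniserial: "uniserial R"
proof -
  have right: "right_uniserial R"
    using right_uniserial_iff divides_total by blast
  moreover have "left_uniserial R"
    unfolding left_uniserial_def
  proof (intro allI impI)
    fix I J assume "left_ideal I R" "left_ideal J R"
    then have "right_ideal I R" "right_ideal J R"
      using left_ideal_eq_pow right_ideal_multiples nat_pow_closed[OF p_closed] by metis+
    then show "I \<subseteq> J \<or> J \<subseteq> I"
      using right by (simp add: right_uniserial_def)
  qed
  ultimately show ?thesis
    by (simp add: uniserial_def)
qed

end

subsection \<open>The non-nilpotent case\<close>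

locale non_nilpotent_uniformized_chain_ring = uniformized_chain_ring +
  assumes pow_neq_zero: "\<And>k :: nat. p [^] k \<noteq> \<zero>"
begin

section \<open>The ideal \<open>P\<close> of the opening outline and its generator\<close>

definition core :: "'a set"
  where "core = {a \<in> carrier R. \<forall>k :: nat. p [^] k divides a}"

lemma core_closed: "a \<in> core \<Longrightarrow> a \<in> carrier R"
  by (simp add: core_def)

lemma core_mult_right: "a \<in> core \<Longrightarrow> r \<in> carrier R \<Longrightarrow> a \<otimes> r \<in> core"
  by (simp add: core_def divides_prod_r)

lemma core_mult_left:
  assumes "a \<in> core" "r \<in> carrier R"
  shows "r \<otimes> a \<in> core"
proof -
  have "p [^] k divides (r \<otimes> a)" for k :: nat
  proof -
    obtain x where x: "x \<in> carrier R" "a = p [^] k \<otimes> x"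
      using assms(1) by (auto simp: core_def)
    obtain s where s: "s \<in> carrier R" "r \<otimes> p [^] k = p [^] k \<otimes> s"
      using pow_commute[OF assms(2)] .
    have "r \<otimes> a = r \<otimes> p [^] k \<otimes> x"
      using x assms(2) by (simp add: m_assoc)
    also have "\<dots> = p [^] k \<otimes> (s \<otimes> x)"
      using x s by (simp add: m_assoc)
    finally show ?thesis
      using x(1) s(1) by (intro dividesI[of "s \<otimes> x"]) auto
  qed
  then show ?thesis
    using assms by (simp add: core_def)
qed

text \<open>Were the cofactor \<open>b\<close> outside the core, it would be a unit multiple of some
  \<open>p [^] m\<close>, giving \<open>a\<close> the exact exponent \<open>Suc m\<close>.\<close>

lemma core_eq_uniformizer_mult:
  assumes a: "a \<in> core"
  obtains b where "b \<in> core" "a = p \<otimes> b"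
proof -
  have "p [^] (1::nat) divides a"
    using a unfolding core_def by blast
  then obtain b where b: "b \<in> carrier R" "a = p \<otimes> b"
    by auto
  have "p [^] k divides b" for k :: nat
  proof (rule ccontr)
    assume "\<not> p [^] k divides b"
    then obtain m :: nat and u where m: "u \<in> Units R" "b = p [^] m \<otimes> u"
      using eq_pow_mult_unit[OF b(1)] by blast
    \<comment> \<open>One exponent beyond \<open>Suc m\<close>, so that a factor \<open>p\<close> is
      left over for Nakayama's lemma.\<close>
    have "p [^] Suc (Suc m) divides a"
      using a unfolding core_def by blast
    then obtain v where v: "v \<in> carrier R" "a = p [^] Suc (Suc m) \<otimes> v"
      by blast
    have pm: "p \<otimes> p [^] m = p [^] Suc m"
      using nat_pow_Suc2[OF p_closed, of m] by simp
    have "p [^] Suc m = p [^] Suc m \<otimes> u \<otimes> inv u"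
      using m(1) by (simp add: m_assoc Units_closed del: nat_pow_Suc)
    also have "p [^] Suc m \<otimes> u = p \<otimes> p [^] m \<otimes> u"
      unfolding pm ..
    also have "p \<otimes> p [^] m \<otimes> u = a"
      using m b(2) by (simp add: m_assoc Units_closed)
    also have "a \<otimes> inv u = p [^] Suc m \<otimes> (p \<otimes> (v \<otimes> inv u))"
      using v m(1) by (simp add: m_assoc)
    finally have "p [^] Suc m = \<zero>"
      using v(1) m(1) by (intro nakayama_right[OF _ nonunit_mult_right[OF uniformizer]]) auto
    then show False
      using pow_neq_zero by blast
  qed
  then have "b \<in> core"
    using b(1) by (simp add: core_def)
  then show thesis
    using that b(2) by blast
qed

lemma core_eq_pow_mult:
  assumes "a \<in> core"
  shows "\<exists>b\<in>core. a = p [^] (k :: nat) \<otimes> b"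
proof (induction k)
  case 0
  then show ?case
    using assms core_closed by (intro bexI[of _ a]) auto
next
  case (Suc k)
  then obtain b where b: "b \<in> core" "a = p [^] k \<otimes> b" by blast
  obtain b' where b': "b' \<in> core" "b = p \<otimes> b'"
    using core_eq_uniformizer_mult[OF b(1)] .
  have "a = p [^] Suc k \<otimes> b'"
    using b(2) b' core_closed[OF b'(1)] by (simp add: m_assoc)
  then show ?case
    using b'(1) by blast
qed

lemma core_generator: "\<exists>q\<in>core. \<forall>b\<in>core. q divides b"
proof (rule least_divisor)
  show "core \<subseteq> carrier R"
    using core_closed by blast
  have "p [^] k divides \<zero>" for k :: nat
    by (auto intro: dividesI[of \<zero>])
  then show "core \<noteq> {}"
    by (auto simp: core_def)
qed

text \<open>Outside the core, \<open>c\<close> would divide some \<open>p [^] k\<close>, and hence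
  the core generator \<open>q\<close>, with cofactor in the core, thus in \<open>qR\<close>. Moving
  the central \<open>c\<close> past \<open>q\<close> gives
  \<open>q = q \<otimes> (c \<otimes> s)\<close>, so \<open>q = \<zero>\<close>.\<close>

lemma central_nonunit_in_core:
  assumes a: "a \<in> core" "a \<noteq> \<zero>"
    and c: "c \<in> ring_center R" "c \<notin> Units R"
  shows "c \<in> core"
proof (rule ccontr)
  assume "c \<notin> core"
  have cc: "c \<in> carrier R"
    using c(1) center_closed by blast
  obtain k :: nat where "\<not> p [^] k divides c"
    using \<open>c \<notin> core\<close> cc by (auto simp: core_def)
  then obtain y where y: "y \<in> carrier R" "p [^] k = c \<otimes> y"
    using divides_total[OF cc nat_pow_closed[OF p_closed, of k]] by blast
  obtain q where q: "q \<in> core" "\<And>b. b \<in> core \<Longrightarrow> q divides b"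
    using core_generator by blast
  have qc: "q \<in> carrier R"
    using q(1) core_closed by blast
  obtain q' where q': "q' \<in> core" "q = p [^] k \<otimes> q'"
    using core_eq_pow_mult[OF q(1)] by blast
  have q'c: "q' \<in> carrier R"
    using q'(1) core_closed by blast
  obtain s where s: "s \<in> carrier R" "y \<otimes> q' = q \<otimes> s"
    using q(2)[OF core_mult_left[OF q'(1) y(1)]] by blast
  have "q = c \<otimes> (y \<otimes> q')"
    using q'(2) y cc q'c by (simp add: m_assoc)
  also have "\<dots> = c \<otimes> q \<otimes> s"
    using s qc cc by (simp add: m_assoc)
  also have "\<dots> = q \<otimes> (c \<otimes> s)"
    using s qc cc center_commute[OF c(1) qc] by (simp add: m_assoc)
  finally have "q = \<zero>"
    using s(1) c(2) cc by (intro nakayama_right[OF qc nonunit_mult_right[of c s]]) auto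
  then show False
    using q(2)[OF a(1)] a(2) by auto
qed

text \<open>
  The element \<open>d\<close> is chosen with the largest annihilator. Then \<open>p\<close> commutes with all of \<open>R\<close> modulo
  that annihilator, so that \<open>dq = dpq' = dq'p\<close> for a generator \<open>q = pq'\<close> of the core,
  and Nakayama's lemma applies.
\<close>

lemma central_element_annihilating_core:
  assumes a: "a \<in> core" "a \<noteq> \<zero>"
  obtains d where "d \<in> ring_center R" "d \<in> core" "d \<noteq> \<zero>" "\<forall>b\<in>core. d \<otimes> b = \<zero>"
proof -
  \<comment> \<open>The union of the right annihilators of the non-zero central elements of the
    core; a least divisor \<open>r\<close> of it lies in one of them, which is then the
    largest.\<close>
  define A where "A = {r \<in> carrier R. \<exists>d\<in>ring_center R \<inter> core. d \<noteq> \<zero> \<and> d \<otimes> r = \<zero>}"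
  have ac: "a \<in> carrier R"
    using a(1) core_closed by blast
  obtain c where c: "c \<in> ring_center R" "a \<otimes> c \<in> ring_center R" "a \<otimes> c \<noteq> \<zero>"
    using centrally_essentialE[OF central_ess ac a(2)] by blast
  have "a \<otimes> c \<in> core"
    using core_mult_right[OF a(1) center_closed[OF c(1)]] .
  moreover have "a \<otimes> c \<otimes> \<zero> = \<zero>"
    using ac center_closed[OF c(1)] by simp
  ultimately have "\<zero> \<in> A"
    unfolding A_def using c by blast
  then obtain r where r: "r \<in> A" "\<And>s. s \<in> A \<Longrightarrow> r divides s"
    using least_divisor[of A] unfolding A_def by blast
  then obtain d where d: "d \<in> ring_center R" "d \<in> core" "d \<noteq> \<zero>" "d \<otimes> r = \<zero>"
    and rc: "r \<in> carrier R"
    unfolding A_def by blast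
  have dc: "d \<in> carrier R"
    using d(1) center_closed by blast
  have ann: "d \<otimes> s = \<zero>"
    if "s \<in> carrier R" "e \<in> ring_center R" "e \<in> core" "e \<noteq> \<zero>" "e \<otimes> s = \<zero>" for e s
  proof -
    have "r divides s"
      using that r(2) unfolding A_def by blast
    then obtain t where "t \<in> carrier R" "s = r \<otimes> t" by blast
    then show ?thesis
      using dc rc d(4) by (simp add: m_assoc[symmetric])
  qed
  obtain q where q: "q \<in> core" "\<And>b. b \<in> core \<Longrightarrow> q divides b"
    using core_generator by blast
  have qc: "q \<in> carrier R"
    using q(1) core_closed by blast
  obtain q' where q': "q' \<in> core" "q = p \<otimes> q'"
    using core_eq_uniformizer_mult[OF q(1)] .
  have q'c: "q' \<in> carrier R"
    using q'(1) core_closed by blast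
  have "d \<otimes> q = \<zero>"
  proof (cases "d \<otimes> p = \<zero>")
    case True
    then show ?thesis
      using q' q'c dc by (simp add: m_assoc[symmetric])
  next
    case False
    then obtain c where c: "c \<in> ring_center R" "d \<otimes> p \<otimes> c \<in> ring_center R" "d \<otimes> p \<otimes> c \<noteq> \<zero>"
      using centrally_essentialE[OF central_ess, of "d \<otimes> p"] dc by auto
    have cc: "c \<in> carrier R"
      using c(1) center_closed by blast
    have dpc: "d \<otimes> p \<otimes> c = d \<otimes> c \<otimes> p"
      using dc cc center_commute[OF c(1) p_closed] by (simp add: m_assoc)
    have dcc: "d \<otimes> c \<in> ring_center R" "d \<otimes> c \<in> core" "d \<otimes> c \<noteq> \<zero>"
      using center_mult[OF d(1) c(1)] core_mult_right[OF d(2) cc] c(3) dpc by auto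
    \<comment> \<open>Both \<open>d \<otimes> c\<close> and \<open>d \<otimes> c \<otimes> p\<close>
      are central, so \<open>d \<otimes> c\<close> kills the commutator of \<open>p\<close> and
      \<open>q'\<close>; by \<open>ann\<close>, so does \<open>d\<close>.\<close>
    have "d \<otimes> c \<otimes> (p \<otimes> q') = d \<otimes> c \<otimes> p \<otimes> q'"
      using dc cc q'c by (simp add: m_assoc)
    also have "\<dots> = q' \<otimes> (d \<otimes> c \<otimes> p)"
      using center_commute[OF c(2) q'c] dpc by simp
    also have "\<dots> = d \<otimes> c \<otimes> (q' \<otimes> p)"
      using dc cc q'c center_commute[OF dcc(1) q'c] by (simp add: m_assoc[symmetric])
    finally have "d \<otimes> c \<otimes> (p \<otimes> q' \<ominus> q' \<otimes> p) = \<zero>"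
      using dc cc q'c by (simp add: minus_eq r_distr r_minus r_neg)
    then have "d \<otimes> (p \<otimes> q' \<ominus> q' \<otimes> p) = \<zero>"
      using ann[OF _ dcc] q'c by simp
    then have swap: "d \<otimes> (p \<otimes> q') = d \<otimes> (q' \<otimes> p)"
      using dc q'c by (simp add: minus_eq r_distr r_minus)
         (metis a_minus_def m_closed p_closed r_right_minus_eq)
    obtain s where s: "s \<in> carrier R" "q' = q \<otimes> s"
      using q(2)[OF q'(1)] by blast
    have "d \<otimes> q = d \<otimes> (q' \<otimes> p)"
      using swap q'(2) by simp
    also have "\<dots> = d \<otimes> q \<otimes> (s \<otimes> p)"
      using s dc qc by (simp add: m_assoc)
    finally show ?thesis
      using dc qc by (intro nakayama_right[OF _ nonunit_mult_left[OF uniformizer s(1)]]) auto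
  qed
  have "d \<otimes> b = \<zero>" if b: "b \<in> core" for b
  proof -
    obtain t where "t \<in> carrier R" "b = q \<otimes> t"
      using q(2)[OF b] by blast
    then show ?thesis
      using \<open>d \<otimes> q = \<zero>\<close> dc qc by (simp add: m_assoc[symmetric])
  qed
  then show thesis
    using that d by blast
qed

text \<open>A Hausdorff condition on the filtration of \<open>xR\<close> by the right ideals of
  \<open>x \<otimes> p [^] k\<close>. It passes from \<open>p \<otimes> x\<close> to
  \<open>x\<close> when \<open>x\<close> is central.\<close>

definition separated :: "'a \<Rightarrow> bool"
  where "separated x \<longleftrightarrow> (\<forall>z. (\<forall>k :: nat. (x \<otimes> p [^] k) divides z) \<longrightarrow> z = \<zero>)"

text \<open>Write \<open>z = d \<otimes> r\<close>. If \<open>r\<close> is in the core,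
  \<open>d\<close> kills it; otherwise some \<open>p [^] k\<close> is a proper multiple of
  \<open>r\<close>, and \<open>z\<close> being a multiple of \<open>d \<otimes> p [^] k\<close>
  makes it a non-unit multiple of itself.\<close>

lemma separated_if_annihilates_core:
  assumes d: "d \<in> carrier R" and ann: "\<forall>b\<in>core. d \<otimes> b = \<zero>"
  shows "separated d"
  unfolding separated_def
proof (intro allI impI)
  fix z assume z: "\<forall>k :: nat. (d \<otimes> p [^] k) divides z"
  then have "(d \<otimes> p [^] (0 :: nat)) divides z" by blast
  then obtain r where r: "r \<in> carrier R" "z = d \<otimes> r"
    using d by auto
  show "z = \<zero>"
  proof (cases "r \<in> core")
    case True
    then show ?thesis using ann r(2) by simp
  next
    case False
    then obtain k :: nat where k: "\<not> p [^] k divides r"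
      using r(1) by (auto simp: core_def)
    then obtain s where s: "s \<in> carrier R" "p [^] k = r \<otimes> s"
      using divides_total[OF r(1) nat_pow_closed[OF p_closed, of k]] by blast
    have snu: "s \<in> carrier R - Units R"
    proof -
      have False if u: "s \<in> Units R"
      proof -
        have "r = p [^] k \<otimes> inv s"
          using s r(1) u by (simp add: m_assoc)
        then show False
          using k u by blast
      qed
      then show ?thesis using s(1) by blast
    qed
    obtain t where t: "t \<in> carrier R" "z = d \<otimes> p [^] k \<otimes> t"
      using z by blast
    have "d \<otimes> r \<otimes> (s \<otimes> t) = d \<otimes> p [^] k \<otimes> t"
      using t(1) s r(1) d by (simp add: m_assoc)
    then have "z = z \<otimes> (s \<otimes> t)"
      using t(2) r(2) by simp
    then show ?thesis
      using nonunit_mult_right[OF snu t(1)] r d by (intro nakayama_right[of z]) auto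
  qed
qed

text \<open>
  Among the central separated elements of the core pick \<open>d\<close> with \<open>dR\<close> maximal and write
  \<open>d = px\<close>. A non-unit central multiplier \<open>c\<close> of \<open>x\<close> lies in the core, which forces
  \<open>cx \<in> dp\<^sup>kR\<close> for all \<open>k\<close>, i.e. \<open>cx = 0\<close>. So \<open>x\<close> is central, contradicting maximality.
\<close>

lemma core_trivial:
  assumes a: "a \<in> core"
  shows "a = \<zero>"
proof (rule ccontr)
  assume nz: "a \<noteq> \<zero>"
  define S where "S = {x \<in> ring_center R \<inter> core. x \<noteq> \<zero> \<and> separated x}"
  obtain d0 where d0: "d0 \<in> ring_center R" "d0 \<in> core" "d0 \<noteq> \<zero>"
      "\<forall>b\<in>core. d0 \<otimes> b = \<zero>"
    using central_element_annihilating_core[OF a nz] .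
  have "d0 \<in> S"
    unfolding S_def using d0 separated_if_annihilates_core[OF core_closed[OF d0(2)] d0(4)] by blast
  moreover have "S \<subseteq> carrier R"
    unfolding S_def using core_closed by blast
  ultimately obtain d where "d \<in> S" and max: "\<And>x. x \<in> S \<Longrightarrow> d divides x"
    using least_divisor[of S] by blast
  then have d: "d \<in> ring_center R" "d \<in> core" "d \<noteq> \<zero>" "separated d"
    unfolding S_def by auto
  have dc: "d \<in> carrier R"
    using d(2) core_closed by blast
  obtain x where x: "x \<in> core" "d = p \<otimes> x"
    using core_eq_uniformizer_mult[OF d(2)] .
  have xc: "x \<in> carrier R" "x \<noteq> \<zero>"
    using x core_closed d(3) by auto
  obtain c where c: "c \<in> ring_center R" "x \<otimes> c \<in> ring_center R" "x \<otimes> c \<noteq> \<zero>"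
    using centrally_essentialE[OF central_ess xc] by blast
  have cc: "c \<in> carrier R"
    using c(1) center_closed by blast
  have "c \<in> Units R"
  proof (rule ccontr)
    assume "c \<notin> Units R"
    then have core: "c \<in> core"
      using central_nonunit_in_core[OF a nz c(1)] by blast
    have "(d \<otimes> p [^] k) divides (x \<otimes> c)" for k :: nat
    proof -
      obtain y where y: "y \<in> core" "c = p [^] k \<otimes> y"
        using core_eq_pow_mult[OF core] by blast
      \<comment> \<open>The extra factor \<open>p\<close> meets \<open>x\<close> to form
        \<open>d = p \<otimes> x\<close>, whose centrality then brings it to the front.\<close>
      obtain y' where y': "y' \<in> core" "y = p \<otimes> y'"
        using core_eq_uniformizer_mult[OF y(1)] .
      have yc: "y' \<in> carrier R"
        using y'(1) core_closed by blast
      obtain w where w: "w \<in> carrier R" "y' \<otimes> x = x \<otimes> w"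
        using divides_mult_left[OF xc(1) yc] by blast
      have "x \<otimes> c = c \<otimes> x"
        using center_commute[OF c(1) xc(1)] by simp
      also have "\<dots> = p [^] k \<otimes> (p \<otimes> (y' \<otimes> x))"
        using y(2) y'(2) yc xc(1) by (simp add: m_assoc)
      also have "\<dots> = p [^] k \<otimes> (d \<otimes> w)"
        using w xc(1) x(2) by (simp add: m_assoc)
      also have "\<dots> = d \<otimes> p [^] k \<otimes> w"
        using dc w(1) center_commute[OF d(1) nat_pow_closed[OF p_closed, of k]]
        by (simp add: m_assoc)
      finally show ?thesis
        using w(1) by (rule dividesI[rotated])
    qed
    then show False
      using d(4) c(3) unfolding separated_def by blast
  qed
  then have central: "x \<in> ring_center R"
    using center_of_mult_unit[OF xc(1) c(1) _ c(2)] by blast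
  have step: "x \<otimes> p [^] Suc k = d \<otimes> p [^] k" for k :: nat
    using center_commute[OF central p_closed] x(2) xc(1) nat_pow_Suc2[OF p_closed, of k]
    by (simp add: m_assoc[symmetric] del: nat_pow_Suc)
  have "separated x"
    unfolding separated_def
  proof (intro allI impI)
    fix z assume "\<forall>k :: nat. (x \<otimes> p [^] k) divides z"
    then have "(d \<otimes> p [^] k) divides z" for k :: nat
      using step by metis
    then show "z = \<zero>"
      using d(4) unfolding separated_def by blast
  qed
  then have "d divides x"
    using max central x(1) xc(2) unfolding S_def by blast
  then obtain y where y: "y \<in> carrier R" "x = d \<otimes> y" by blast
  \<comment> \<open>Substituting \<open>d = p \<otimes> x\<close> in
    \<open>x = d \<otimes> y\<close> and commuting \<open>x\<close> with \<open>p\<close>.\<close>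
  then have "x = x \<otimes> (p \<otimes> y)"
    using x(2) xc(1) center_commute[OF central p_closed] by (simp add: m_assoc[symmetric])
  then have "x = \<zero>"
    by (rule nakayama_right[OF xc(1) nonunit_mult_right[OF uniformizer y(1)]])
  then show False
    using xc(2) by blast
qed

section \<open>Integrality and the valuation domain\<close>

lemma nonzero_divides_pow:
  assumes a: "a \<in> carrier R" "a \<noteq> \<zero>"
  shows "\<exists>k :: nat. a divides p [^] k"
proof -
  obtain k :: nat where "\<not> p [^] k divides a"
    using core_trivial[of a] a by (auto simp: core_def)
  then show ?thesis
    using divides_total[OF a(1) nat_pow_closed[OF p_closed, of k]] by blast
qed

text \<open>If \<open>a\<close> and \<open>b\<close> divide powers of \<open>p\<close>,
  two-sidedness of \<open>bR\<close> turns the product of these powers into a multiple of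
  \<open>a \<otimes> b\<close>, whereas no power of \<open>p\<close> vanishes.\<close>

lemma integral:
  assumes a: "a \<in> carrier R" and b: "b \<in> carrier R" and ab: "a \<otimes> b = \<zero>"
  shows "a = \<zero> \<or> b = \<zero>"
proof (rule ccontr)
  assume "\<not> (a = \<zero> \<or> b = \<zero>)"
  then obtain k l :: nat where "a divides p [^] k" "b divides p [^] l"
    using nonzero_divides_pow[OF a] nonzero_divides_pow[OF b] by blast
  then obtain x y where x: "x \<in> carrier R" "p [^] k = a \<otimes> x"
    and y: "y \<in> carrier R" "p [^] l = b \<otimes> y"
    by blast
  obtain x' where x': "x' \<in> carrier R" "x \<otimes> b = b \<otimes> x'"
    using divides_mult_left[OF b x(1)] by blast
  have "p [^] (k + l) = a \<otimes> (x \<otimes> b) \<otimes> y"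
    using x y a b by (simp add: nat_pow_mult[OF p_closed, symmetric] m_assoc)
  also have "\<dots> = a \<otimes> b \<otimes> x' \<otimes> y"
    using x' y a b by (simp add: m_assoc)
  also have "\<dots> = \<zero>"
    using ab x'(1) y(1) by simp
  finally show False
    using pow_neq_zero by blast
qed

lemma discrete_valuation_domain: "discrete_valuation_domain R"
proof -
  have comm: "a \<otimes> b = b \<otimes> a" if "a \<in> carrier R" "b \<in> carrier R" for a b
    using centrally_essential_domain_commutative[OF central_ess integral that] by blast
  interpret cring R
    by unfold_locales (rule comm)
  interpret domain R
    by unfold_locales (use one_not_zero integral in auto)
  have "principal_domain R"
  proof
    fix I assume I: "ideal I R"
    interpret I: ideal I R by fact
    obtain a where a: "a \<in> I" "\<And>b. b \<in> I \<Longrightarrow> a divides b"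
      using least_divisor[OF I.a_subset] I.zero_closed by blast
    have "I = PIdl a"
    proof
      show "I \<subseteq> PIdl a"
        using a I.a_subset comm unfolding cgenideal_def by (fastforce simp: factor_def)
      show "PIdl a \<subseteq> I"
        using a(1) cgenideal_minimal[OF I] by blast
    qed
    then show "\<exists>a\<in>carrier R. I = PIdl a"
      using a(1) I.a_subset by blast
  qed
  moreover have "\<exists>!M. maximalideal M R \<and> M \<noteq> {\<zero>}"
  proof (rule ex1I[of _ "PIdl p"], intro conjI maximalidealI)
    \<comment> \<open>This ideal consists of all non-units, so it contains every proper ideal and is
      the only maximal one.\<close>
    have mem: "x \<in> PIdl p \<longleftrightarrow> x \<in> carrier R - Units R" for x
    proof
      assume "x \<in> PIdl p"
      then show "x \<in> carrier R - Units R"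
        using nonunit_mult_left[OF uniformizer] unfolding cgenideal_def by blast
    next
      assume "x \<in> carrier R - Units R"
      then obtain y where "y \<in> carrier R" "x = p \<otimes> y"
        using uniformizer_divides by blast
      then show "x \<in> PIdl p"
        using comm[OF p_closed] unfolding cgenideal_def by blast
    qed
    have proper: "J \<subseteq> PIdl p" if J: "ideal J R" "J \<noteq> carrier R" for J
    proof
      fix x assume x: "x \<in> J"
      have "x \<in> carrier R"
        using x additive_subgroup.a_subset[OF ideal.axioms(1)[OF J(1)]] by blast
      moreover have "x \<notin> Units R"
      proof
        assume "x \<in> Units R"
        then have "\<one> \<in> J"
          using ideal.I_l_closed[OF J(1) x, of "inv x"] by simp
        then show False
          using ideal.one_imp_carrier[OF J(1)] J(2) by blast
      qed
      ultimately show "x \<in> PIdl p"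
        using mem by blast
    qed
    show id: "ideal (PIdl p) R"
      by (rule cgenideal_ideal[OF p_closed])
    show ne: "carrier R \<noteq> PIdl p"
      using mem[of \<one>] by auto
    show "J = PIdl p \<or> J = carrier R" if "ideal J R" "PIdl p \<subseteq> J" for J
      using proper[OF that(1)] that(2) by blast
    show "PIdl p \<noteq> {\<zero>}"
      using mem[of p] uniformizer pow_neq_zero[of 1] by auto
    fix M assume M: "maximalideal M R \<and> M \<noteq> {\<zero>}"
    then interpret M: maximalideal M R by blast
    have "M \<subseteq> PIdl p"
      using proper[OF M.is_ideal] M.I_notcarr by blast
    then show "M = PIdl p"
      using M.I_maximal[OF id] ne additive_subgroup.a_subset[OF ideal.axioms(1)[OF id]] by blast
  qed
  ultimately show ?thesis
    by (simp add: discrete_valuation_domain_def discrete_valuation_domain_axioms_def)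
qed

end

lemma (in ring) dvd_or_artinian_if_noetherian:
  assumes "\<one> \<noteq> \<zero>" "centrally_essential R" "right_uniserial R" "right_noetherian R"
  shows "discrete_valuation_domain R \<or> uniserial R \<and> artinian R"
proof -
  interpret right_chain_noetherian_ring R
    using assms(1,3,4) by (rule right_chain_noetherian_ringI)
  obtain p where p: "p \<in> carrier R - Units R" "\<And>j. j \<in> carrier R - Units R \<Longrightarrow> p divides j"
    using exists_uniformizer by blast
  interpret uniformized_chain_ring R p
    by unfold_locales (use p assms(2) in auto)
  show ?thesis
  proof (cases "\<exists>n :: nat. p [^] n = \<zero>")
    \<comment> \<open>Division rings belong here, with \<open>p = \<zero>\<close> and
      \<open>n = 1\<close>.\<close>
    case True
    define n :: nat where "n = (LEAST n. p [^] n = \<zero>)"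
    have "p [^] n = \<zero>"
      unfolding n_def using True by (rule LeastI_ex)
    moreover have "p [^] m \<noteq> \<zero>" if "m < n" for m
      using that unfolding n_def by (rule not_less_Least)
    ultimately interpret nilpotent_uniformized_chain_ring R p n
      by unfold_locales
    show ?thesis
      using uniserial artinian by blast
  next
    case False
    then interpret non_nilpotent_uniformized_chain_ring R p
      by unfold_locales blast
    show ?thesis
      using discrete_valuation_domain by blast
  qed
qed

section \<open>The converse\<close>

text \<open>Divide \<open>a\<close> and \<open>b\<close> by a generator \<open>d\<close> of the
  ideal they span. If neither cofactor is a unit, both lie in the maximal ideal, and cancelling
  \<open>d\<close> in the Bezout relation puts \<open>\<one>\<close> there too.\<close>

lemma (in discrete_valuation_domain) divides_total:
  assumes a: "a \<in> carrier R" and b: "b \<in> carrier R"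
  shows "a divides b \<or> b divides a"
proof -
  obtain M where M: "\<And>N. maximalideal N R \<Longrightarrow> N \<noteq> {\<zero>} \<Longrightarrow> N = M"
      "maximalideal M R"
    using unique_nonzero_maximal by blast
  interpret M: maximalideal M R by (rule M(2))
  \<comment> \<open>An irreducible divisor generates a non-zero maximal ideal, which must be
    \<open>M\<close>.\<close>
  have nonunit: "x \<in> M" if x: "x \<in> carrier R - Units R" for x
  proof (cases "x = \<zero>")
    case True
    then show ?thesis using M.zero_closed by simp
  next
    case False
    then obtain q where q: "q \<in> carrier R" "ring_irreducible q" "q divides x"
      using exists_irreducible_divisor[of x] x by blast
    have "maximalideal (PIdl q) R"
      using irreducible_imp_maximalideal[OF q(1,2)] .
    moreover have "PIdl q \<noteq> {\<zero>}"
      using cgenideal_self[OF q(1)] ring_irreducibleE(1)[OF q(1,2)] by auto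
    ultimately have "PIdl q = M"
      by (rule M(1))
    then have "q \<in> M"
      using cgenideal_self[OF q(1)] by blast
    then show ?thesis
      using q(3) M.I_r_closed by blast
  qed
  have "ideal (PIdl a <+> PIdl b) R"
    using add_ideals[OF cgenideal_ideal[OF a] cgenideal_ideal[OF b]] .
  then obtain d where d: "d \<in> carrier R" "PIdl a <+> PIdl b = PIdl d"
    using exists_gen by blast
  have sum: "u \<oplus> v \<in> PIdl d" if "u \<in> PIdl a" "v \<in> PIdl b" for u v
    using that unfolding d(2)[symmetric] set_add_def' by blast
  have "\<zero> \<in> PIdl a" "\<zero> \<in> PIdl b"
    using cgenideal_ideal a b by (auto intro: additive_subgroup.zero_closed ideal.axioms(1))
  then have "a \<in> PIdl d" "b \<in> PIdl d"
    using sum[of a \<zero>] sum[of \<zero> b] cgenideal_self a b by auto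
  then obtain a' b' where a': "a' \<in> carrier R" "a = a' \<otimes> d" and b': "b' \<in> carrier R" "b = b' \<otimes> d"
    unfolding cgenideal_def by blast
  have "d \<in> PIdl a <+> PIdl b"
    using cgenideal_self[OF d(1)] d(2) by simp
  then obtain x y where x: "x \<in> carrier R" and y: "y \<in> carrier R" and xy: "d = x \<otimes> a \<oplus> y \<otimes> b"
    unfolding cgenideal_def set_add_def' by blast
  have unit: "u \<otimes> d divides v \<otimes> d" if u: "u \<in> Units R" and v: "v \<in> carrier R" for u v
  proof (rule dividesI)
    show "inv u \<otimes> v \<in> carrier R"
      using u v by simp
    have "u \<otimes> d \<otimes> (inv u \<otimes> v) = (u \<otimes> inv u) \<otimes> (v \<otimes> d)"
      using u v d(1) Units_inv_closed[OF u] Units_closed[OF u]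
      by (simp add: m_ac del: Units_r_inv Units_l_inv)
    then show "v \<otimes> d = u \<otimes> d \<otimes> (inv u \<otimes> v)"
      using u v d(1) by simp
  qed
  consider "d = \<zero>" | "a' \<in> Units R" | "b' \<in> Units R" | "d \<noteq> \<zero>" "a' \<in> M" "b' \<in> M"
    using nonunit a'(1) b'(1) by blast
  then show ?thesis
  proof cases
    case 1
    then have "a = \<zero>" "b = \<zero>"
      using a' b' by auto
    then show ?thesis by auto
  next
    case 2
    then show ?thesis using unit a' b' by auto
  next
    case 3
    then show ?thesis using unit a' b' by auto
  next
    case 4
    have "(x \<otimes> a' \<oplus> y \<otimes> b') \<otimes> d = x \<otimes> (a' \<otimes> d) \<oplus> y \<otimes> (b' \<otimes> d)"
      using x y a'(1) b'(1) d(1) by (simp add: l_distr m_assoc)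
    then have "(x \<otimes> a' \<oplus> y \<otimes> b') \<otimes> d = \<one> \<otimes> d"
      by (simp only: a'(2)[symmetric] b'(2)[symmetric] xy[symmetric] l_one[OF d(1)])
    then have "x \<otimes> a' \<oplus> y \<otimes> b' = \<one>"
      using m_rcancel[OF 4(1) d(1), of "x \<otimes> a' \<oplus> y \<otimes> b'" \<one>] x y a'(1) b'(1) by simp
    moreover have "x \<otimes> a' \<oplus> y \<otimes> b' \<in> M"
      using 4 x y M.I_l_closed M.a_closed by simp
    ultimately have "M = carrier R"
      using M.one_imp_carrier by simp
    then show ?thesis
      using M.I_notcarr by simp
  qed
qed

text \<open>The union of the chain is principal, and its generator already occurs at a finite
  stage.\<close>

lemma (in discrete_valuation_domain) right_noetherian: "right_noetherian R"
  unfolding right_noetherian_def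
proof (intro allI impI)
  fix I :: "nat \<Rightarrow> 'a set"
  assume right: "\<forall>n. right_ideal (I n) R" and "mono I"
  then have U: "right_ideal (\<Union>n. I n) R"
    by (intro right_ideal_Union_mono) auto
  have sub: "(\<Union>n. I n) \<subseteq> carrier R"
    using right_ideal_subset[OF U] .
  have "ideal (\<Union>n. I n) R"
    using U m_comm right_ideal.r_closed[OF U] sub
    by (auto simp: ideal_def ideal_axioms_def right_ideal_def subset_iff)
  then obtain a where a: "a \<in> carrier R" "(\<Union>n. I n) = PIdl a"
    using exists_gen by blast
  then obtain N where N: "a \<in> I N"
    using cgenideal_self[OF a(1)] by blast
  have "I n = I N" if "n \<ge> N" for n
  proof
    show "I N \<subseteq> I n"
      using \<open>mono I\<close> that by (rule monoD)
    have "I n \<subseteq> PIdl a"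
      using a(2) by blast
    moreover have "PIdl a \<subseteq> I N"
      using right_ideal.r_closed[OF right[rule_format] N] m_comm a(1)
      unfolding cgenideal_def by auto
    ultimately show "I n \<subseteq> I N" by blast
  qed
  then show "\<exists>N. \<forall>n\<ge>N. I n = I N" by blast
qed

theorem theorem1:
  fixes R (structure)
  assumes "ring R" and "\<one> \<noteq> \<zero>" and "centrally_essential R"
  shows "right_uniserial R \<and> right_noetherian R \<longleftrightarrow>
    discrete_valuation_domain R \<or> (uniserial R \<and> artinian R)"
proof -
  interpret ring R by fact
  have "right_uniserial R \<and> right_noetherian R" if dvd: "discrete_valuation_domain R"
  proof -
    interpret discrete_valuation_domain R by fact
    show ?thesis
      using right_uniserial_iff divides_total right_noetherian by blast
  qed
  moreover have "right_uniserial R \<and> right_noetherian R" if "uniserial R" "artinian R"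
  proof -
    have uni: "right_uniserial R" and art: "left_artinian R"
      using that by (auto simp: uniserial_def artinian_def)
    interpret right_chain_ring R
      by unfold_locales (use assms(2) uni right_uniserial_iff in auto)
    show ?thesis
      using uni right_noetherian_if_left_artinian[OF art] by blast
  qed
  ultimately show ?thesis
    using dvd_or_artinian_if_noetherian[OF assms(2,3)] by blast
qed

end
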